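(* For every $f\in L^{1}(\mathbb{R})\cap L^{2}(\mathbb{R})$ the inequality $$\int_{-1/2}^{1/2}\int_{\mathbb{R}}f(x)f(x+t)\,dx\,dt\leq 0.864\,\|f\|_1\|f\|_2$$ holds, and the constant $0.864$ cannot be replaced by $0.8$ (that is, the inequality with $0.8$ in place of $0.864$ fails for some $f\in L^{1}(\mathbb{R})\cap L^{2}(\mathbb{R})$).
   Context: Functions are real-valued, $f:\mathbb{R}\to\mathbb{R}$, and $\|f\|_p$ denotes the $L^p(\mathbb{R})$ norm with respect to Lebesgue measure. *)

theory Defs
  imports "HOL-Analysis.Analysis"
begin

text \<open>Spaces of functions rather than of almost-everywhere classes; p is a finite
  exponent.  Measurability is with respect to Lebesgue measurable sets on the domain.\<close>

definition Lp_space :: "real \<Rightarrow> (real \<Rightarrow> real) set" where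
  "Lp_space p = {f \<in> borel_measurable lebesgue. integrable lebesgue (\<lambda>x. \<bar>f x\<bar> powr p)}"

definition Lp_norm :: "real \<Rightarrow> (real \<Rightarrow> real) \<Rightarrow> real" where
  "Lp_norm p f = (LINT x|lebesgue. \<bar>f x\<bar> powr p) powr (1 / p)"

end

theory Submission
  imports Defs "HOL-Probability.Characteristic_Functions"
begin

text \<open>
  Let $c = 0.4274 = 2137/5000$ and $\rho(t) = \int f(x) f(x+t)\,dx$, where $f \ge 0$ without loss of generality.
  Since $\sin a - c \sin(7a/5) \le c a$ for all $a \ge 0$, the Fourier transform of
  $1_{[-1/2,1/2]} - c\,1_{[-7/10,7/10]}$ is at most $c$.  As $\rho$ has nonnegative Fourier transform,
  $\int_{-1/2}^{1/2} \rho - c \int_{-7/10}^{7/10} \rho \le c\,\rho(0)$, and so the left-hand side $Q$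
  of the claim is at most $c(\|f\|_1^2 + \|f\|_2^2)$.  Together with the trivial bounds
  $Q \le \|f\|_1^2$ and $Q \le \|f\|_2^2$ this gives the constant 0.864, because
  $c \le C^2/(1+C^2)$ for $C = 0.864$.  Fourier inversion is only needed with Gaussian damping.
  For the constant 0.8 the counterexample is $1 - 4x^2$ on $[-1/2,1/2]$, where $Q = 47/120$.
\<close>

section \<open>The trigonometric inequality\<close>

text \<open>The difference \<open>g - f\<close> is nondecreasing on the half-line. This lets Taylor
  bounds be integrated one degree at a time.\<close>

lemma le_on_nonneg_if_deriv_le:
  fixes f g :: "real \<Rightarrow> real"
  assumes "0 \<le> x" and "f 0 \<le> g 0"
    and "\<And>t. 0 \<le> t \<Longrightarrow> (f has_real_derivative f' t) (at t)"
    and "\<And>t. 0 \<le> t \<Longrightarrow> (g has_real_derivative g' t) (at t)"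
    and "\<And>t. 0 \<le> t \<Longrightarrow> f' t \<le> g' t"
  shows "f x \<le> g x"
proof -
  have "g 0 - f 0 \<le> g x - f x"
  proof (rule DERIV_nonneg_imp_nondecreasing[OF assms(1)])
    fix t :: real assume "0 \<le> t"
    then show "\<exists>y. ((\<lambda>t. g t - f t) has_real_derivative y) (at t) \<and> 0 \<le> y"
      using assms(3,4,5) by (intro exI[of _ "g' t - f' t"]) (auto intro!: DERIV_diff)
  qed
  then show ?thesis using assms(2) by simp
qed

text \<open>Starting from sin t \<le> t, each bound is the previous one integrated from 0, so that
  sine and cosine, and upper and lower bounds, alternate.\<close>

lemma sin_cos_taylor_bounds:
  fixes x :: real
  assumes "0 \<le> x"
  shows "sin x \<le> x - x^3/6 + x^5/120"
    and "x - x^3/6 + x^5/120 - x^7/5040 \<le> sin x"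
    and "cos x \<le> 1 - x^2/2 + x^4/24"
proof -
  have c2: "1 - t^2/2 \<le> cos t" if "0 \<le> t" for t :: real
    by (rule le_on_nonneg_if_deriv_le[OF that, where f' = "\<lambda>t. -t" and g' = "\<lambda>t. - sin t"])
       (auto intro!: derivative_eq_intros sin_x_le_x)
  have s3: "t - t^3/6 \<le> sin t" if "0 \<le> t" for t :: real
    by (rule le_on_nonneg_if_deriv_le[OF that, where f' = "\<lambda>t. 1 - t^2/2" and g' = cos])
       (auto intro!: derivative_eq_intros c2)
  have c4: "cos t \<le> 1 - t^2/2 + t^4/24" if "0 \<le> t" for t :: real
    by (rule le_on_nonneg_if_deriv_le[OF that, where g' = "\<lambda>t. - (t - t^3/6)" and f' = "\<lambda>t. - sin t"])
       (auto intro!: derivative_eq_intros dest: s3)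
  have s5: "sin t \<le> t - t^3/6 + t^5/120" if "0 \<le> t" for t :: real
    by (rule le_on_nonneg_if_deriv_le[OF that, where g' = "\<lambda>t. 1 - t^2/2 + t^4/24" and f' = cos])
       (auto intro!: derivative_eq_intros c4)
  have c6: "1 - t^2/2 + t^4/24 - t^6/720 \<le> cos t" if "0 \<le> t" for t :: real
    by (rule le_on_nonneg_if_deriv_le[OF that, where f' = "\<lambda>t. - (t - t^3/6 + t^5/120)" and g' = "\<lambda>t. - sin t"])
       (auto intro!: derivative_eq_intros dest: s5)
  have s7: "t - t^3/6 + t^5/120 - t^7/5040 \<le> sin t" if "0 \<le> t" for t :: real
    by (rule le_on_nonneg_if_deriv_le[OF that, where f' = "\<lambda>t. 1 - t^2/2 + t^4/24 - t^6/720" and g' = cos])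
       (auto intro!: derivative_eq_intros c6)
  show "sin x \<le> x - x^3/6 + x^5/120" "x - x^3/6 + x^5/120 - x^7/5040 \<le> sin x"
    "cos x \<le> 1 - x^2/2 + x^4/24"
    using s5 s7 c4 assms by auto
qed

text \<open>The quotient by $a$ of the Taylor bounds for $ca - \sin a + c \sin(7a/5)$, in $z = a^2$.\<close>

lemma sin_diff_taylor_cubic_nonneg:
  fixes z :: real
  assumes "0 \<le> z" "z \<le> 841/100"
  shows "0 \<le> (12/5 * (2137/5000) - 1) - ((2137/5000) * (7/5)^3 - 1) / 6 * z
    + ((2137/5000) * (7/5)^5 - 1) / 120 * z^2 - (2137/5000) * (7/5)^7 / 5040 * z^3"
proof -
  \<comment> \<open>The coefficients of \<open>?p\<close> are rounded downwards as signed numbers,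
    so \<open>?p\<close> is a lower bound for z \<ge> 0.\<close>
  let ?p = "\<lambda>z::real. 0.02576 - 0.0287983 * z + 0.01082202 * z^2 - 0.000894 * z^3"
  have "?p z \<le> (12/5 * (2137/5000) - 1) - ((2137/5000) * (7/5)^3 - 1) / 6 * z
    + ((2137/5000) * (7/5)^5 - 1) / 120 * z^2 - (2137/5000) * (7/5)^7 / 5040 * z^3"
  proof -
    have *: "?p z \<le> 0.02576 - A * z + B * z^2 - C * z^3"
      if "A \<le> 0.0287983" "0.01082202 \<le> B" "C \<le> 0.000894" for A B C :: real
      using that assms(1) by (intro add_mono diff_mono mult_right_mono) auto
    show ?thesis using *[of "((2137/5000) * (7/5)^3 - 1) / 6" "((2137/5000) * (7/5)^5 - 1) / 120" "(2137/5000) * (7/5)^7 / 5040"]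
      by (simp add: power_divide)
  qed
  moreover have "0 \<le> ?p z"
  proof (cases "z \<le> 3")
    case True
    \<comment> \<open>On [0, 3] the cubic term is absorbed into the quadratic one. Completing the
      square leaves a minimum of about 0.00029, so the rounding above has little slack.\<close>
    have "z^2 * (0.000894 * z) \<le> z^2 * (0.000894 * 3)"
      using True by (intro mult_left_mono) auto
    then have "0.02576 - 0.0287983 * z + 0.00814002 * z^2 \<le> ?p z"
      by (simp add: power2_eq_square power3_eq_cube algebra_simps)
    moreover have "0.02576 - 0.0287983 * z + 0.00814002 * z^2
        = 0.00814002 * (z - 0.0287983 / (2 * 0.00814002))^2 + (0.02576 - 0.0287983^2 / (4 * 0.00814002))"
      by (simp add: power2_eq_square field_simps)
    moreover have "0 \<le> 0.00814002 * (z - 0.0287983 / (2 * 0.00814002))^2"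
      by simp
    moreover have "0 \<le> (0.02576::real) - 0.0287983^2 / (4 * 0.00814002)"
      by (simp add: power2_eq_square)
    ultimately show ?thesis by linarith
  next
    case False
    define u where "u = z - 3"
    have u: "0 \<le> u" "u \<le> 541/100" and z: "z = 3 + u" using False assms by (auto simp: u_def)
    \<comment> \<open>Here 541/100 = 841/100 - 3 is the largest value of \<open>u\<close>.
      \<open>E\<close> carries the whole cubic term in \<open>u\<close>; what remains of
      \<open>?p\<close> is quadratic, and its coefficients dominate the round numbers 0.012, 0.0119
      and -0.0021.\<close>
    define E where "E = u * ((541/100 - u) * (0.000894 * u))"
    have E: "0 \<le> E" unfolding E_def using u by (intro mult_nonneg_nonneg) auto
    have "u * u \<le> 541/100 * u" using u by (intro mult_right_mono) auto
    with E u have "0 \<le> E + 0.0119 * u + 0.012 - 0.0021 * (u * u)" by simp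
    moreover have "E + 0.0119 * u + 0.012 - 0.0021 * (u * u) \<le> ?p z"
    proof -
      have eq: "?p z - (E + 0.0119 * u + 0.012 - 0.0021 * (u * u))
       = 0.02576 - 0.0287983 * 3 + 0.01082202 * 9 - 0.000894 * 27 - 0.012
        + (-0.0287983 + 6 * 0.01082202 - 27*0.000894 - 0.0119) * u
        + (0.0021 + 0.01082202 - 9 * 0.000894 - 541/100*0.000894) * (u * u)"
       unfolding z E_def by (simp add: power2_eq_square power3_eq_cube field_simps)
      have "0 \<le> ?p z - (E + 0.0119 * u + 0.012 - 0.0021 * (u * u))"
        unfolding eq using u by (intro add_nonneg_nonneg mult_nonneg_nonneg) auto
      then show ?thesis by simp
    qed
    ultimately show ?thesis by linarith
  qed
  ultimately show ?thesis by linarith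
qed

text \<open>Write c for 2137/5000. Taylor bounds settle a \<le> 29/10, whose square is 841/100.
  Beyond that, sin(7a/5) is only bounded below by -1, and c * a is already large enough.\<close>

lemma sin_diff_le:
  fixes a :: real
  assumes a: "0 \<le> a"
  shows "sin a - (2137/5000) * sin (7/5 * a) \<le> (2137/5000) * a"
proof (cases "a \<le> 29/10")
  case True
  have "sin a - (2137/5000) * sin (7/5 * a) \<le> a - a^3/6 + a^5/120
    - (2137/5000) * (7/5 * a - (7/5 * a)^3/6 + (7/5 * a)^5/120 - (7/5 * a)^7/5040)"
    using sin_cos_taylor_bounds(1)[OF a] sin_cos_taylor_bounds(2)[of "7/5 * a"] a by (intro diff_mono mult_left_mono) auto
  also have "\<dots> = (2137/5000) * a - a * ((12/5 * (2137/5000) - 1) - ((2137/5000) * (7/5)^3 - 1) / 6 * a^2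
    + ((2137/5000) * (7/5)^5 - 1) / 120 * (a^2)^2 - (2137/5000) * (7/5)^7 / 5040 * (a^2)^3)"
    by (simp add: power_mult_distrib power_divide field_simps power_numeral_reduce)
  also have "\<dots> \<le> (2137/5000) * a"
  proof -
    have "a^2 \<le> (29/10)^2" using a True by (intro power_mono) auto
    then have "a^2 \<le> 841/100" by (simp add: power2_eq_square)
    from mult_nonneg_nonneg[OF a sin_diff_taylor_cubic_nonneg[OF _ this]] show ?thesis by simp
  qed
  finally show ?thesis .
next
  case False
  show ?thesis
  \<comment> \<open>The threshold lies just above (1 + c) / c: for larger a the trivial bound 1 + c
    = 1.4274 suffices, as c * 167/50 = 1.427516.\<close>
  proof (cases "a \<le> 167/50")
    case True
    \<comment> \<open>A negative cosine places 1.8 beyond pi/2; this crude upper bound on pi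
      controls sin a to the left of pi.\<close>
    have "cos (1.8::real) < 0"
      using sin_cos_taylor_bounds(3)[of "1.8"] by (simp add: power_divide)
    then have "pi \<le> 3.6"
      using cos_ge_zero[of "1.8"] pi_gt3 by (cases "pi / 2 \<le> 1.8") auto
    \<comment> \<open>The value 4/5 is small enough because 4/5 + c = 1.2274 is below c * 29/10 =
      1.23946.\<close>
    have "sin a \<le> 4/5"
    proof (cases "a \<le> pi")
      case True
      have "sin a = sin (pi - a)" by simp
      also have "\<dots> \<le> pi - a" using True by (intro sin_x_le_x) simp
      finally show ?thesis using \<open>pi \<le> 3.6\<close> False by simp
    next
      case F3: False
      then have "sin a \<le> 0" using True pi_gt3 by (intro sin_le_zero) auto
      then show ?thesis by simp
    qed
    moreover have "- 1 \<le> sin (7/5 * a)" by simp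
    ultimately show ?thesis using False by linarith
  next
    case F2: False
    have "sin a \<le> 1" "- 1 \<le> sin (7/5 * a)" by simp_all
    then show ?thesis using F2 by linarith
  qed
qed

section \<open>Autocorrelation and its cosine transform\<close>

definition autocorr :: "(real \<Rightarrow> real) \<Rightarrow> real \<Rightarrow> real" where
  "autocorr f t = (LINT x|lborel. f x * f (x + t))"

lemma autocorr_measurable [measurable]:
  assumes [measurable]: "f \<in> borel_measurable borel"
  shows "autocorr f \<in> borel_measurable borel"
  unfolding autocorr_def by measurable

lemma integrable_translate:
  fixes g :: "real \<Rightarrow> real"
  assumes "integrable lborel g" shows "integrable lborel (\<lambda>x. g (x + t))"
  using lborel_integrable_real_affine[OF assms, of 1 t] by (simp add: add.commute)

lemma integral_translate:
  fixes g :: "real \<Rightarrow> real"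
  shows "(LINT x|lborel. g (x + t)) = (LINT x|lborel. g x)"
  using lborel_integral_real_affine[of 1 g t] by (simp add: add.commute)

lemma abs_mult_le_avg_squares: "\<bar>a * b\<bar> \<le> (a\<^sup>2 + b\<^sup>2) / 2" for a b :: real
proof -
  have "2 * (\<bar>a\<bar> * \<bar>b\<bar>) \<le> \<bar>a\<bar>\<^sup>2 + \<bar>b\<bar>\<^sup>2"
    using sum_squares_bound[of "\<bar>a\<bar>" "\<bar>b\<bar>"] by (simp add: mult.assoc)
  then show ?thesis by (simp add: abs_mult)
qed

lemma autocorr_minus: "autocorr f (- t) = autocorr f t"
  using integral_translate[of "\<lambda>x. f x * f (x - t)" t] by (simp add: autocorr_def mult.commute)

context
  fixes f :: "real \<Rightarrow> real"
  assumes f_meas [measurable]: "f \<in> borel_measurable borel"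
    and f_int: "integrable lborel f"
    and f_sq: "integrable lborel (\<lambda>x. (f x)\<^sup>2)"
begin

lemma autocorr_integrable: "integrable lborel (\<lambda>x. f x * f (x + t))"
proof (rule Bochner_Integration.integrable_bound)
  show "integrable lborel (\<lambda>x. ((f x)\<^sup>2 + (f (x + t))\<^sup>2) / 2)"
    using f_sq integrable_translate[OF f_sq] by auto
  show "AE x in lborel. norm (f x * f (x + t)) \<le> norm (((f x)\<^sup>2 + (f (x + t))\<^sup>2) / 2)"
    using abs_mult_le_avg_squares by auto
qed measurable

text \<open>A pointwise arithmetic-geometric mean bound takes the place of Cauchy-Schwarz: by
  translation invariance both squares have the same integral.\<close>

lemma abs_autocorr_le: "\<bar>autocorr f t\<bar> \<le> (LINT x|lborel. (f x)\<^sup>2)"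
proof -
  have "\<bar>autocorr f t\<bar> \<le> (LINT x|lborel. \<bar>f x * f (x + t)\<bar>)"
    unfolding autocorr_def by (rule integral_abs_bound)
  also have "\<dots> \<le> (LINT x|lborel. ((f x)\<^sup>2 + (f (x + t))\<^sup>2) / 2)"
    using f_sq integrable_translate[OF f_sq] autocorr_integrable abs_mult_le_avg_squares
    by (intro integral_mono) auto
  also have "\<dots> = (LINT x|lborel. (f x)\<^sup>2)"
    using f_sq integrable_translate[OF f_sq] integral_translate[of "\<lambda>x. (f x)\<^sup>2"] by simp
  finally show ?thesis .
qed

text \<open>The inner integral of |f(x + t)| over t is the L1 norm of f for every x, so the double
  integral is finite. This justifies the later exchanges of integrals.\<close>

lemma autocorr_pair_integrable:
  "integrable (lborel \<Otimes>\<^sub>M lborel) (\<lambda>(x, t). f x * f (x + t))"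
proof (rule lborel_pair.Fubini_integrable)
  have "(LINT t|lborel. \<bar>f (x + t)\<bar>) = (LINT t|lborel. \<bar>f t\<bar>)" for x
    using integral_translate[of "\<lambda>t. \<bar>f t\<bar>" x] by (simp add: add.commute)
  then show "integrable lborel (\<lambda>x. LINT y|lborel. norm (case (x, y) of (x, t) \<Rightarrow> f x * f (x + t)))"
    using f_int by (simp add: abs_mult)
  show "AE x in lborel. integrable lborel (\<lambda>y. case (x, y) of (x, t) \<Rightarrow> f x * f (x + t))"
    using integrable_translate[OF f_int] by (simp add: add.commute)
qed measurable

lemma integrable_autocorr: "integrable lborel (autocorr f)"
  using lborel_pair.integrable_snd[OF autocorr_pair_integrable] by (simp add: autocorr_def[abs_def])

text \<open>The Wiener-Khinchin identity: substitute y = x + t and expand cos(w(y - x)). It makes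
  the transform of the autocorrelation nonnegative.\<close>

lemma autocorr_cos_transform:
  "(LINT t|lborel. autocorr f t * cos (w * t))
    = (LINT x|lborel. f x * cos (w * x))\<^sup>2 + (LINT x|lborel. f x * sin (w * x))\<^sup>2"
proof -
  have bd: "integrable lborel (\<lambda>x. f x * g x)"
    if [measurable]: "g \<in> borel_measurable borel" and "\<And>x. \<bar>g x\<bar> \<le> 1" for g :: "real \<Rightarrow> real"
    by (rule Bochner_Integration.integrable_bound[OF f_int])
       (use that(2) in \<open>auto simp: abs_mult intro!: mult_left_le\<close>)
  have ic: "integrable lborel (\<lambda>x. f x * cos (w * x))" and isn: "integrable lborel (\<lambda>x. f x * sin (w * x))"
    by (rule bd; simp)+
  have "integrable (lborel \<Otimes>\<^sub>M lborel) (\<lambda>(x, t). f x * f (x + t) * cos (w * t))"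
    by (rule Bochner_Integration.integrable_bound[OF autocorr_pair_integrable])
       (auto simp: abs_mult intro!: AE_I2 mult_left_le)
  from lborel_pair.Fubini_integral[OF this]
  have "(LINT t|lborel. autocorr f t * cos (w * t))
      = (LINT x|lborel. LINT t|lborel. f x * f (x + t) * cos (w * t))"
    by (simp add: autocorr_def)
  also have "\<dots> = (LINT x|lborel. (f x * cos (w * x)) * (LINT x|lborel. f x * cos (w * x))
      + (f x * sin (w * x)) * (LINT x|lborel. f x * sin (w * x)))"
  proof (rule Bochner_Integration.integral_cong[OF refl])
    fix x
    have "(LINT t|lborel. f x * f (x + t) * cos (w * t)) = (LINT y|lborel. f x * f y * cos (w * (y - x)))"
      using integral_translate[of "\<lambda>y. f x * f y * cos (w * (y - x))" x] by (simp add: add.commute)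
    also have "\<dots> = (LINT y|lborel. (f x * cos (w * x)) * (f y * cos (w * y)) + (f x * sin (w * x)) * (f y * sin (w * y)))"
      by (simp add: right_diff_distrib cos_diff algebra_simps)
    also have "\<dots> = (f x * cos (w * x)) * (LINT x|lborel. f x * cos (w * x))
      + (f x * sin (w * x)) * (LINT x|lborel. f x * sin (w * x))"
      using ic isn by simp
    finally show "(LINT t|lborel. f x * f (x + t) * cos (w * t)) = \<dots>" .
  qed
  also have "\<dots> = (LINT x|lborel. f x * cos (w * x))\<^sup>2 + (LINT x|lborel. f x * sin (w * x))\<^sup>2"
    using ic isn by (simp add: power2_eq_square)
  finally show ?thesis .
qed

lemma integral_autocorr: "(LINT t|lborel. autocorr f t) = (LINT x|lborel. f x)\<^sup>2"
  using autocorr_cos_transform[of 0] by simp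

end

section \<open>Gaussian-damped Fourier inversion for interval indicators\<close>

interpretation std_normal: real_distribution std_normal_distribution
  by (rule real_dist_normal_dist)

lemma integral_std_normal_cos:
  "(LINT z|std_normal_distribution. cos (y * z)) = exp (- y\<^sup>2 / 2)"
proof -
  have "Re (iexp (y * z)) = cos (y * z)" for z
    by (simp only: cis_conv_exp[symmetric] cis.simps)
  then have "(LINT z|std_normal_distribution. cos (y * z)) = Re (char std_normal_distribution y)"
    unfolding char_def by (subst integral_Re[symmetric]) (auto intro!: std_normal.integrable_iexp)
  then show ?thesis by (simp add: char_std_normal_distribution Re_exp)
qed

lemma prob_std_normal_UNIV: "std_normal.prob UNIV = 1"
  using std_normal.prob_space by simp

lemma integrable_indicator_Icc: "integrable lborel (indicator {a..b} :: real \<Rightarrow> real)"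
  by (cases "a \<le> b") simp_all

text \<open>The Fourier transform of the interval indicator, real by symmetry. The integral form,
  unlike 2 sin(rw)/w, also has the right value at w = 0.\<close>

definition interval_cos :: "real \<Rightarrow> real \<Rightarrow> real" where
  "interval_cos r w = (LINT s|lborel. indicator {-r..r} s * cos (w * s))"

lemma interval_cos_measurable [measurable]: "interval_cos r \<in> borel_measurable borel"
  unfolding interval_cos_def by measurable

lemma interval_cos_eq:
  assumes "w \<noteq> 0" and "0 \<le> r"
  shows "interval_cos r w = 2 * sin (r * w) / w"
proof -
  have "(LINT s|lborel. indicator {-r..r} s *\<^sub>R cos (w * s)) = sin (w * r) / w - sin (w * (-r)) / w"
    using assms
    by (intro integral_FTC_Icc) (auto intro!: derivative_eq_intros continuous_intros
      simp: has_real_derivative_iff_has_vector_derivative[symmetric])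
  then show ?thesis by (simp add: interval_cos_def mult.commute)
qed

lemma abs_interval_cos_le:
  assumes "0 \<le> r" shows "\<bar>interval_cos r w\<bar> \<le> 2 * r"
proof -
  have "\<bar>interval_cos r w\<bar> \<le> (LINT s|lborel. \<bar>indicator {-r..r} s * cos (w * s)\<bar>)"
    unfolding interval_cos_def by (rule integral_abs_bound)
  also have "\<dots> \<le> (LINT s|lborel. indicator {-r..r} s)"
    by (rule integral_mono'[OF integrable_indicator_Icc]) (auto simp: abs_mult split: split_indicator)
  also have "\<dots> = 2 * r" using assms by simp
  finally show ?thesis .
qed

text \<open>Of the two terms in the expansion of cos(w(s - t)), the one with sin(ws) is odd in s and
  integrates to zero.\<close>

lemma interval_cos_shift:
  "(LINT s|lborel. indicator {-r..r} s * cos (w * (s - t))) = cos (w * t) * interval_cos r w"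
proof -
  have bd: "integrable lborel (\<lambda>s. indicator {-r..r} s * g s)"
    if "g \<in> borel_measurable borel" "\<And>s. \<bar>g s\<bar> \<le> 1" for g :: "real \<Rightarrow> real"
    using that by (intro Bochner_Integration.integrable_bound[OF integrable_indicator_Icc])
       (auto simp: abs_mult split: split_indicator)
  have i: "integrable lborel (\<lambda>s. indicator {-r..r} s * cos (w * s))"
    "integrable lborel (\<lambda>s. indicator {-r..r} s * sin (w * s))"
    by (rule bd; simp)+
  have "(LINT s|lborel. indicator {-r..r} s * sin (w * s))
      = (LINT s|lborel. indicator {-r..r} (- s) * sin (w * (- s)))"
    using lborel_integral_real_affine[of "-1" "\<lambda>s. indicator {-r..r} s * sin (w * s)" 0] by simp
  also have "\<dots> = (LINT s|lborel. - (indicator {-r..r} s * sin (w * s)))"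
    by (intro Bochner_Integration.integral_cong) (auto simp: indicator_def)
  finally have odd: "(LINT s|lborel. indicator {-r..r} s * sin (w * s)) = 0" by simp
  have "(LINT s|lborel. indicator {-r..r} s * cos (w * (s - t)))
      = (LINT s|lborel. cos (w * t) * (indicator {-r..r} s * cos (w * s)) + sin (w * t) * (indicator {-r..r} s * sin (w * s)))"
    by (intro Bochner_Integration.integral_cong) (simp_all add: right_diff_distrib cos_diff distrib_left mult_ac)
  also have "\<dots> = cos (w * t) * interval_cos r w"
    using i odd by (simp add: interval_cos_def)
  finally show ?thesis .
qed

text \<open>The indicator of an interval convolved with the Gaussian of standard deviation $e$.\<close>

definition smoothed_interval :: "real \<Rightarrow> real \<Rightarrow> real \<Rightarrow> real" where
  "smoothed_interval e r t = (LINT z|std_normal_distribution. indicator {-r..r} (t + e * z))"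

lemma smoothed_interval_measurable [measurable]: "smoothed_interval e r \<in> borel_measurable borel"
  unfolding smoothed_interval_def by measurable

lemma smoothed_interval_bounds: "0 \<le> smoothed_interval e r t" "smoothed_interval e r t \<le> 1"
proof -
  show "0 \<le> smoothed_interval e r t"
    unfolding smoothed_interval_def by (intro Bochner_Integration.integral_nonneg) simp
  have "smoothed_interval e r t \<le> (LINT z|std_normal_distribution. 1)"
    unfolding smoothed_interval_def
    by (intro integral_mono') (auto simp: indicator_def)
  then show "smoothed_interval e r t \<le> 1" by (simp add: prob_std_normal_UNIV)
qed

text \<open>Away from the endpoints the indicator is locally constant, so for each fixed z the
  integrand is eventually constant; dominated convergence gives the limit.\<close>

lemma smoothed_interval_tendsto:
  assumes t: "\<bar>t\<bar> \<noteq> r" and e: "e \<longlonglongrightarrow> 0"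
  shows "(\<lambda>n. smoothed_interval (e n) r t) \<longlonglongrightarrow> indicator {-r..r} t"
proof -
  have "(\<lambda>n. LINT z|std_normal_distribution. (indicator {-r..r} (t + e n * z) :: real))
      \<longlonglongrightarrow> (LINT z|std_normal_distribution. (indicator {-r..r} t :: real))"
  proof (rule integral_dominated_convergence[where w = "\<lambda>_. 1"])
    show "AE z in std_normal_distribution. (\<lambda>n. indicator {-r..r} (t + e n * z) :: real) \<longlonglongrightarrow> indicator {-r..r} t"
    proof (rule AE_I2)
      fix z :: real
      have lim: "(\<lambda>n. t + e n * z) \<longlonglongrightarrow> t"
        using tendsto_add[OF tendsto_const tendsto_mult_left_zero[OF e]] by simp
      have "\<forall>\<^sub>F n in sequentially. (t + e n * z \<in> {-r..r}) = (t \<in> {-r..r})"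
      proof (cases "t \<in> {-r..r}")
        case True
        then have "t \<in> {-r<..<r}" using t by auto
        then have "\<forall>\<^sub>F n in sequentially. t + e n * z \<in> {-r<..<r}"
          using topological_tendstoD[OF lim open_greaterThanLessThan] by blast
        then show ?thesis by eventually_elim (use True in auto)
      next
        case False
        have "open (- {-r..r})" by (simp add: open_Compl)
        then have "\<forall>\<^sub>F n in sequentially. t + e n * z \<in> - {-r..r}"
          using topological_tendstoD[OF lim] False by blast
        then show ?thesis by eventually_elim (use False in auto)
      qed
      then show "(\<lambda>n. indicator {-r..r} (t + e n * z) :: real) \<longlonglongrightarrow> indicator {-r..r} t"
        by (intro tendsto_eventually) (auto elim!: eventually_mono simp: indicator_def)
    qed
  qed (auto simp: indicator_def)
  then show ?thesis by (simp add: smoothed_interval_def prob_std_normal_UNIV)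
qed

text \<open>The Gaussian is its own Fourier transform up to a factor. This is the source of the
  inversion formula for \<open>smoothed_interval\<close>.\<close>

lemma std_normal_density_eq:
  "std_normal_density y = (1 / sqrt (2 * pi)) * (LINT z|std_normal_distribution. cos (y * z))"
  by (subst integral_std_normal_cos) (rule std_normal_density_def)

text \<open>After the substitution s = t + e * z, the density is replaced by its cosine integral and
  Fubini moves the s-integral inside, where it is a shifted \<open>interval_cos\<close>.\<close>

lemma smoothed_interval_fourier:
  assumes e: "0 < e"
  shows "smoothed_interval e r t = 1 / (e * sqrt (2 * pi)) *
    (LINT z|std_normal_distribution. cos (z / e * t) * interval_cos r (z / e))"
proof -
  have int: "integrable (lborel \<Otimes>\<^sub>M std_normal_distribution)
    (\<lambda>(s, z). indicator {-r..r} s * cos (z / e * (s - t)))"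
  proof -
    interpret pair_sigma_finite lborel std_normal_distribution
      by (intro pair_sigma_finite.intro sigma_finite_lborel std_normal.sigma_finite_measure_axioms)
    have "integrable (lborel \<Otimes>\<^sub>M std_normal_distribution) (\<lambda>(s, z). indicator {-r..r} s :: real)"
      using integrable_indicator_Icc[of "-r" r]
      by (intro Fubini_integrable) (simp_all add: prob_std_normal_UNIV)
    then show ?thesis
      by (rule Bochner_Integration.integrable_bound) (auto simp: abs_mult indicator_def intro!: AE_I2)
  qed
  have "smoothed_interval e r t = (LINT z|lborel. std_normal_density z * indicator {-r..r} (t + e * z))"
    unfolding smoothed_interval_def by (subst integral_density) auto
  also have "\<dots> = (1 / e) * (LINT s|lborel. std_normal_density ((s - t) / e) * indicator {-r..r} s)"
  proof -
    have "- t / e + 1 / e * s = (s - t) / e" "t + e * ((s - t) / e) = s" for s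
      using e by (simp_all add: field_simps)
    then show ?thesis
      using e by (subst lborel_integral_real_affine[of "1 / e" _ "- t / e"]) simp_all
  qed
  also have "\<dots> = (1 / e) * (LINT s|lborel. (1 / sqrt (2 * pi)) *
     (LINT z|std_normal_distribution. indicator {-r..r} s * cos (z / e * (s - t))))"
    by (rule arg_cong[where f = "\<lambda>x. 1 / e * x"], rule Bochner_Integration.integral_cong[OF refl],
        subst std_normal_density_eq) (simp add: mult.commute)
  also have "\<dots> = 1 / (e * sqrt (2 * pi)) * (LINT s|lborel.
     (LINT z|std_normal_distribution. indicator {-r..r} s * cos (z / e * (s - t))))"
    by simp
  also have "(LINT s|lborel. (LINT z|std_normal_distribution. indicator {-r..r} s * cos (z / e * (s - t))))
     = (LINT z|std_normal_distribution. (LINT s|lborel. indicator {-r..r} s * cos (z / e * (s - t))))"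
  proof -
    interpret pair_sigma_finite lborel std_normal_distribution
      by (intro pair_sigma_finite.intro sigma_finite_lborel std_normal.sigma_finite_measure_axioms)
    show ?thesis using Fubini_integral[OF int] by simp
  qed
  finally show ?thesis by (simp only: interval_cos_shift)
qed

section \<open>The spectral inequality\<close>

text \<open>With c = 2137/5000, this is the Fourier transform of c times the unit point mass at 0,
  minus the indicator of [-1/2, 1/2], plus c times the indicator of [-7/10, 7/10].\<close>

definition symbol :: "real \<Rightarrow> real" where
  "symbol w = 2137/5000 - interval_cos (1/2) w + 2137/5000 * interval_cos (7/10) w"

lemma symbol_measurable [measurable]: "symbol \<in> borel_measurable borel"
  unfolding symbol_def by measurable

text \<open>For a = |w|/2, the product a * \<open>symbol w\<close> is the nonnegative quantity c * a
  - sin a + c * sin(7a/5) of \<open>sin_diff_le\<close>.\<close>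

lemma symbol_nonneg:
  assumes "w \<noteq> 0" shows "0 \<le> symbol w"
proof -
  define a where "a = \<bar>w\<bar> / 2"
  have a: "0 < a" using assms by (simp add: a_def)
  have even: "sin (r * w) / w = sin (r * \<bar>w\<bar>) / \<bar>w\<bar>" for r
    by (cases "0 \<le> w") auto
  have "symbol w = 2137/5000 - 2 * (sin (1/2 * w) / w) + 2137/5000 * (2 * (sin (7/10 * w) / w))"
    using assms by (simp add: symbol_def interval_cos_eq)
  also have "\<dots> = (2137/5000 * a - sin a + 2137/5000 * sin (7/5 * a)) / a"
    unfolding even using a by (simp add: a_def field_simps)
  also have "\<dots> \<ge> 0" using sin_diff_le[of a] a by (intro divide_nonneg_pos) auto
  finally show ?thesis .
qed

lemma abs_symbol_le: "\<bar>symbol w\<bar> \<le> 3"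
  using abs_interval_cos_le[of "1/2" w] abs_interval_cos_le[of "7/10" w]
  by (simp add: symbol_def)

lemma integrable_std_normal_bounded:
  fixes g :: "real \<Rightarrow> real"
  assumes [measurable]: "g \<in> borel_measurable borel" and "\<And>x. \<bar>g x\<bar> \<le> b"
  shows "integrable std_normal_distribution g"
  using assms by (intro std_normal.integrable_const_bound[of _ b]) auto

context
  fixes \<rho> :: "real \<Rightarrow> real" and B :: real
  assumes meas [measurable]: "\<rho> \<in> borel_measurable borel"
    and int: "integrable lborel \<rho>"
    and bound: "\<And>t. \<bar>\<rho> t\<bar> \<le> B"
    and transform: "\<And>w. 0 \<le> (LINT t|lborel. \<rho> t * cos (w * t))"
begin

lemma integrable_smoothed: "integrable lborel (\<lambda>t. \<rho> t * smoothed_interval e r t)"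
  by (rule Bochner_Integration.integrable_bound[OF int])
     (auto simp: abs_mult smoothed_interval_bounds intro!: AE_I2 mult_left_le)

text \<open>The transform of \<open>\<rho>\<close> times \<open>symbol\<close> is nonnegative, hence
  so is its Gaussian average. Fubini rewrites that average as \<open>\<rho>\<close> integrated
  against the damped inverse transform of \<open>symbol\<close>.\<close>

lemma smoothed_spectral_bound:
  assumes e: "0 < e"
  shows "(LINT t|lborel. \<rho> t * smoothed_interval e (1/2) t)
    - 2137/5000 * (LINT t|lborel. \<rho> t * smoothed_interval e (7/10) t) \<le> 2137/5000 * B"
proof -
  define k where "k = 1 / (e * sqrt (2 * pi))"
  have k: "0 \<le> k" using e by (simp add: k_def)
  interpret pair_sigma_finite lborel std_normal_distribution
    by (intro pair_sigma_finite.intro sigma_finite_lborel std_normal.sigma_finite_measure_axioms)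
  \<comment> \<open>The point mass in the kernel is smoothed to a normal density of standard
    deviation \<open>e\<close>; its total mass 1 later gives the bound \<open>B\<close>.\<close>
  have gauss: "k * (LINT z|std_normal_distribution. cos (z / e * t)) = normal_density 0 e t" for t
    using integral_std_normal_cos[of "t / e"] e
    by (simp add: k_def normal_density_def real_sqrt_mult power_divide mult.commute[of t] mult.commute[of "e\<^sup>2"] mult.commute[of e])
  have kernel: "k * (LINT z|std_normal_distribution. cos (z / e * t) * symbol (z / e))
    = 2137/5000 * normal_density 0 e t - smoothed_interval e (1/2) t + 2137/5000 * smoothed_interval e (7/10) t" for t
  proof -
    have i: "integrable std_normal_distribution (\<lambda>z. cos (z / e * t) * interval_cos r (z / e))" if "0 \<le> r" for r
    proof (rule integrable_std_normal_bounded)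
      show "\<bar>cos (z / e * t) * interval_cos r (z / e)\<bar> \<le> 1 * (2 * r)" for z
        unfolding abs_mult using that by (intro mult_mono abs_interval_cos_le) auto
    qed simp
    have ic: "integrable std_normal_distribution (\<lambda>z. cos (z / e * t))"
      by (rule integrable_std_normal_bounded[of _ 1]) auto
    have "(LINT z|std_normal_distribution. cos (z / e * t) * symbol (z / e))
      = (LINT z|std_normal_distribution. 2137/5000 * cos (z / e * t) - cos (z / e * t) * interval_cos (1/2) (z / e)
         + 2137/5000 * (cos (z / e * t) * interval_cos (7/10) (z / e)))"
      by (rule Bochner_Integration.integral_cong) (simp_all add: symbol_def algebra_simps)
    also have "\<dots> = 2137/5000 * (LINT z|std_normal_distribution. cos (z / e * t))
      - (LINT z|std_normal_distribution. cos (z / e * t) * interval_cos (1/2) (z / e))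
      + 2137/5000 * (LINT z|std_normal_distribution. cos (z / e * t) * interval_cos (7/10) (z / e))"
      using i[of "1/2"] i[of "7/10"] ic by (subst Bochner_Integration.integral_add Bochner_Integration.integral_diff; simp)+
    finally show ?thesis
      unfolding gauss[symmetric] smoothed_interval_fourier[OF e] k_def[symmetric]
      by (simp only: distrib_left right_diff_distrib mult.left_commute)
  qed
  have pair: "integrable (lborel \<Otimes>\<^sub>M std_normal_distribution) (\<lambda>(t, z). \<rho> t * (cos (z / e * t) * symbol (z / e)))"
  proof (rule Bochner_Integration.integrable_bound)
    show "integrable (lborel \<Otimes>\<^sub>M std_normal_distribution) (\<lambda>(t, z). 3 * \<rho> t)"
      using int by (intro Fubini_integrable) (simp_all add: prob_std_normal_UNIV)
    have "\<bar>cos (z / e * t) * symbol (z / e)\<bar> \<le> 1 * 3" for t z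
      unfolding abs_mult by (intro mult_mono abs_symbol_le) auto
    then have "\<bar>\<rho> t * (cos (z / e * t) * symbol (z / e))\<bar> \<le> 3 * \<bar>\<rho> t\<bar>" for t z
      unfolding abs_mult[of "\<rho> t"] by (metis abs_ge_zero mult.commute mult_1 mult_left_mono)
    then show "AE x in lborel \<Otimes>\<^sub>M std_normal_distribution.
      norm (case x of (t, z) \<Rightarrow> \<rho> t * (cos (z / e * t) * symbol (z / e))) \<le> norm (case x of (t, z) \<Rightarrow> 3 * \<rho> t)"
      by (intro AE_I2) (auto simp: abs_mult)
  qed measurable
  \<comment> \<open>For fixed z the inner integral factors into the transform of
    \<open>\<rho>\<close> at z/e times \<open>symbol (z / e)\<close>; the point z = 0 is a null
    set.\<close>
  have "0 \<le> (LINT z|std_normal_distribution. LINT t|lborel. \<rho> t * (cos (z / e * t) * symbol (z / e)))"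
  proof (rule integral_nonneg_AE)
    have "AE z in lborel. z \<noteq> (0::real)" by (rule AE_lborel_singleton)
    then have "AE z in std_normal_distribution. z \<noteq> 0"
      by (subst AE_density) auto
    then show "AE z in std_normal_distribution. 0 \<le> (LINT t|lborel. \<rho> t * (cos (z / e * t) * symbol (z / e)))"
    proof eventually_elim
      case (elim z)
      have "(LINT t|lborel. \<rho> t * (cos (z / e * t) * symbol (z / e))) = (LINT t|lborel. \<rho> t * cos (z / e * t)) * symbol (z / e)"
        by (simp only: integral_mult_left_zero mult.assoc[symmetric])
      with symbol_nonneg[of "z / e"] transform[of "z / e"] elim e show ?case by simp
    qed
  qed
  also have "\<dots> = (LINT t|lborel. \<rho> t * (LINT z|std_normal_distribution. cos (z / e * t) * symbol (z / e)))"
    by (subst Fubini_integral[OF pair]) (simp only: integral_mult_right_zero)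
  finally have "0 \<le> k * \<dots>" using k by simp
  also have "\<dots> = (LINT t|lborel. \<rho> t * (2137/5000 * normal_density 0 e t - smoothed_interval e (1/2) t
      + 2137/5000 * smoothed_interval e (7/10) t))"
    by (simp only: kernel[symmetric] integral_mult_right_zero[symmetric] mult.left_commute)
  also have "\<dots> = (LINT t|lborel. 2137/5000 * (\<rho> t * normal_density 0 e t) - \<rho> t * smoothed_interval e (1/2) t
      + 2137/5000 * (\<rho> t * smoothed_interval e (7/10) t))"
    by (rule Bochner_Integration.integral_cong) (simp_all add: algebra_simps)
  also have "\<dots> = 2137/5000 * (LINT t|lborel. \<rho> t * normal_density 0 e t)
      - (LINT t|lborel. \<rho> t * smoothed_interval e (1/2) t)
      + 2137/5000 * (LINT t|lborel. \<rho> t * smoothed_interval e (7/10) t)"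
  proof -
    have "integrable lborel (\<lambda>t. \<rho> t * normal_density 0 e t)"
      by (rule Bochner_Integration.integrable_bound[of lborel "\<lambda>t. B * normal_density 0 e t"])
         (use e bound in \<open>auto simp: abs_mult intro!: AE_I2 mult_right_mono order_trans[OF bound]\<close>)
    then show ?thesis using integrable_smoothed by simp
  qed
  also have "(LINT t|lborel. \<rho> t * normal_density 0 e t) \<le> B"
  proof -
    have "\<rho> t \<le> B" "0 \<le> B" for t using bound[of t] by auto
    then have "(LINT t|lborel. \<rho> t * normal_density 0 e t) \<le> (LINT t|lborel. B * normal_density 0 e t)"
      using e by (intro integral_mono') (auto intro!: mult_right_mono)
    then show ?thesis using e by simp
  qed
  finally show ?thesis by simp
qed

text \<open>Let the standard deviation 1/(n + 1) tend to 0. Dominated convergence applies with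
  majorant |\<open>\<rho>\<close>|, the interval endpoints forming a null set.\<close>

lemma spectral_bound:
  "(LINT t|lborel. \<rho> t * indicator {-(1/2)..1/2} t)
    - 2137/5000 * (LINT t|lborel. \<rho> t * indicator {-(7/10)..7/10} t) \<le> 2137/5000 * B"
proof (rule LIMSEQ_le_const2)
  have "(\<lambda>n. LINT t|lborel. \<rho> t * smoothed_interval (1 / Suc n) r t)
      \<longlonglongrightarrow> (LINT t|lborel. \<rho> t * indicator {-r..r} t)" for r
  proof (rule integral_dominated_convergence[where w = "\<lambda>t. \<bar>\<rho> t\<bar>"])
    have "AE t in lborel. t \<noteq> r" "AE t in lborel. t \<noteq> -r" by (rule AE_lborel_singleton)+
    then show "AE t in lborel. (\<lambda>n. \<rho> t * smoothed_interval (1 / Suc n) r t) \<longlonglongrightarrow> \<rho> t * indicator {-r..r} t"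
    proof eventually_elim
      case (elim t)
      then show ?case
        using LIMSEQ_inverse_real_of_nat
        by (intro tendsto_mult tendsto_const smoothed_interval_tendsto)
           (auto simp: inverse_eq_divide abs_if split: if_splits)
    qed
  qed (use int in \<open>auto simp: abs_mult smoothed_interval_bounds intro!: AE_I2 mult_left_le\<close>)
  then show "(\<lambda>n. (LINT t|lborel. \<rho> t * smoothed_interval (1 / Suc n) (1/2) t)
    - 2137/5000 * (LINT t|lborel. \<rho> t * smoothed_interval (1 / Suc n) (7/10) t))
    \<longlonglongrightarrow> (LINT t|lborel. \<rho> t * indicator {-(1/2)..1/2} t)
    - 2137/5000 * (LINT t|lborel. \<rho> t * indicator {-(7/10)..7/10} t)"
    by (intro tendsto_diff tendsto_mult tendsto_const)
  show "\<exists>N. \<forall>n\<ge>N. (LINT t|lborel. \<rho> t * smoothed_interval (1 / Suc n) (1/2) t)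
    - 2137/5000 * (LINT t|lborel. \<rho> t * smoothed_interval (1 / Suc n) (7/10) t) \<le> 2137/5000 * B"
    using smoothed_spectral_bound by auto
qed

end

section \<open>The upper bound for nonnegative functions\<close>

lemma set_integral_autocorr_le:
  fixes f :: "real \<Rightarrow> real"
  assumes f: "integrable lborel f" "integrable lborel (\<lambda>x. (f x)\<^sup>2)" and nonneg: "\<And>x. 0 \<le> f x"
  shows "(LINT t|lborel. autocorr f t * indicator {-(1/2)..1/2} t)
    \<le> 0.864 * (LINT x|lborel. f x) * sqrt (LINT x|lborel. (f x)\<^sup>2)"
proof -
  have f_meas: "f \<in> borel_measurable borel" using borel_measurable_integrable[OF f(1)] by simp
  note autocorr = f_meas f
  note [measurable] = autocorr_measurable[OF f_meas]
  define p q Q where "p = (LINT x|lborel. f x)" and "q = sqrt (LINT x|lborel. (f x)\<^sup>2)"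
    and "Q = (LINT t|lborel. autocorr f t * indicator {-(1/2)..1/2} t)"
  have p: "0 \<le> p" unfolding p_def using nonneg by (intro Bochner_Integration.integral_nonneg) auto
  have q: "0 \<le> q" unfolding q_def by (intro real_sqrt_ge_zero Bochner_Integration.integral_nonneg) auto
  have q2: "(LINT x|lborel. (f x)\<^sup>2) = q\<^sup>2"
    unfolding q_def by (subst real_sqrt_pow2) (auto intro: Bochner_Integration.integral_nonneg)
  have ac: "0 \<le> autocorr f t" "autocorr f t \<le> q\<^sup>2" for t
    using abs_autocorr_le[OF autocorr, of t] nonneg q2
    by (auto simp: autocorr_def intro!: Bochner_Integration.integral_nonneg)
  \<comment> \<open>As the autocorrelation is nonnegative, any window integral is at most its total
    mass.\<close>
  have window: "(LINT t|lborel. autocorr f t * indicator {a..b} t) \<le> p\<^sup>2" for a b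
  proof -
    have "(LINT t|lborel. autocorr f t * indicator {a..b} t) \<le> (LINT t|lborel. autocorr f t)"
      using integrable_autocorr[OF autocorr] ac
      by (intro integral_mono') (auto split: split_indicator)
    then show ?thesis by (simp add: integral_autocorr[OF autocorr] p_def)
  qed
  have "Q \<le> (LINT t|lborel. q\<^sup>2 * indicator {-(1/2)..1/2::real} t)"
    unfolding Q_def using ac by (intro integral_mono') (auto split: split_indicator)
  then have Q2: "Q \<le> q\<^sup>2" by simp
  have "Q - 2137/5000 * (LINT t|lborel. autocorr f t * indicator {-(7/10)..7/10} t) \<le> 2137/5000 * q\<^sup>2"
    unfolding Q_def
    using abs_autocorr_le[OF autocorr] autocorr_cos_transform[OF autocorr]
    by (intro spectral_bound integrable_autocorr[OF autocorr] autocorr_measurable f_meas) (auto simp: q2)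
  then have Q3: "Q \<le> 2137/5000 * (p\<^sup>2 + q\<^sup>2)" using window[of "-(7/10)" "7/10"] by simp
  have "Q \<le> 0.864 * p * q"
  proof -
    \<comment> \<open>When the norms are far apart, the smaller of the trivial bounds
      \<open>q\<^sup>2\<close> and \<open>p\<^sup>2\<close> suffices; only comparable norms call for
      the spectral bound \<open>Q3\<close>.\<close>
    consider "q \<le> 0.864 * p" | "p \<le> 0.864 * q" | "0.864 * p \<le> q" "0.864 * q \<le> p" by linarith
    then show ?thesis
    proof cases
      case 1
      then have "q * q \<le> 0.864 * p * q" using q by (intro mult_right_mono)
      then show ?thesis using Q2 by (simp add: power2_eq_square)
    next
      case 2
      then have "p * p \<le> p * (0.864 * q)" using p by (intro mult_left_mono)
      then show ?thesis using window[of "-(1/2)" "1/2"] by (simp add: power2_eq_square Q_def mult_ac)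
    next
      case 3
      then have "0 \<le> (q - 0.864 * p) * (p - 0.864 * q)" by (intro mult_nonneg_nonneg) auto
      then have "0.864 * (p\<^sup>2 + q\<^sup>2) \<le> (1 + 0.864\<^sup>2) * (p * q)"
        by (simp add: power2_eq_square field_simps)
      moreover have "0 \<le> p * q" using p q by simp
      \<comment> \<open>With C = 0.864 this needs c * (1 + C^2) \<le> C^2; numerically 0.746452
        against 0.746496.\<close>
      ultimately show ?thesis using Q3 by (simp add: power2_eq_square)
    qed
  qed
  then show ?thesis by (simp add: p_def q_def Q_def)
qed

section \<open>Signed functions and Lebesgue measurability\<close>

text \<open>Passing to the absolute value leaves both norms unchanged, so this reduces the bound to
  nonnegative functions.\<close>

lemma autocorr_mono_abs:
  assumes [measurable]: "f \<in> borel_measurable borel" and "integrable lborel f" "integrable lborel (\<lambda>x. (f x)\<^sup>2)"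
  shows "autocorr f t \<le> autocorr (\<lambda>x. \<bar>f x\<bar>) t"
proof -
  have "integrable lborel (\<lambda>x. \<bar>f x\<bar> * \<bar>f (x + t)\<bar>)"
    using assms by (intro autocorr_integrable) auto
  then show ?thesis
    unfolding autocorr_def using assms
    by (intro integral_mono autocorr_integrable) (auto simp flip: abs_mult)
qed

text \<open>A Lebesgue measurable f agrees almost everywhere with a Borel g. Norms carry over
  directly; correlations do for every t, because translates of null sets are null.\<close>

lemma Lp_spaceE:
  assumes "f \<in> Lp_space 1 \<inter> Lp_space 2"
  obtains g where "g \<in> borel_measurable borel" "integrable lborel g" "integrable lborel (\<lambda>x. (g x)\<^sup>2)"
    "Lp_norm 1 f = (LINT x|lborel. \<bar>g x\<bar>)" "Lp_norm 2 f = sqrt (LINT x|lborel. (g x)\<^sup>2)"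
    "\<And>t. (LINT x|lebesgue. f x * f (x + t)) = autocorr g t"
proof -
  have f [measurable]: "f \<in> borel_measurable lebesgue"
    and f1: "integrable lebesgue (\<lambda>x. \<bar>f x\<bar> powr 1)" and f2: "integrable lebesgue (\<lambda>x. \<bar>f x\<bar> powr 2)"
    using assms by (auto simp: Lp_space_def)
  obtain g where g: "g \<in> borel_measurable lborel" and ae: "AE x in lborel. f x = g x"
    using completion_ex_borel_measurable_real[OF f] by auto
  have [measurable]: "g \<in> borel_measurable borel" using g by simp
  have transfer: "integrable lborel (\<lambda>x. F (g x))" "(LINT x|lebesgue. F (f x)) = (LINT x|lborel. F (g x))"
    if "integrable lebesgue (\<lambda>x. F (f x))" and [measurable]: "F \<in> borel_measurable borel" for F :: "real \<Rightarrow> real"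
  proof -
    have "AE x in lebesgue. F (f x) = F (g x)" using AE_completion[OF ae] by auto
    moreover have "(\<lambda>x. F (g x)) \<in> borel_measurable lebesgue"
      by (rule measurable_completion) measurable
    ultimately have "integrable lebesgue (\<lambda>x. F (g x))" "(LINT x|lebesgue. F (f x)) = (LINT x|lebesgue. F (g x))"
      using that(1) by (auto intro!: integral_cong_AE elim!: integrable_cong_AE_imp)
    then show "integrable lborel (\<lambda>x. F (g x))" "(LINT x|lebesgue. F (f x)) = (LINT x|lborel. F (g x))"
      by (simp_all add: integrable_completion integral_completion)
  qed
  have corr: "(LINT x|lebesgue. f x * f (x + t)) = autocorr g t" for t
  proof -
    \<comment> \<open>This is the general affine map with all scale factors 1; on the reals it
      reduces to translation by \<open>t\<close>.\<close>
    have "(\<lambda>x. t + (\<Sum>j\<in>Basis. (1 * (x \<bullet> j)) *\<^sub>R j)) \<in> lebesgue \<rightarrow>\<^sub>M (lebesgue :: real measure)"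
      by (rule lebesgue_affine_measurable) simp
    then have [measurable]: "(\<lambda>x. x + t) \<in> lebesgue \<rightarrow>\<^sub>M (lebesgue :: real measure)"
      by (simp add: add.commute)
    have "AE x in distr lborel borel ((+) t). f x = g x" using ae unfolding lborel_distr_plus .
    then have "AE x in lborel. f (t + x) = g (t + x)"
      by (rule AE_distrD[rotated]) simp
    then have "AE x in lebesgue. f x * f (x + t) = g x * g (x + t)"
      using ae by (intro AE_completion) (auto simp: add.commute)
    then have "(LINT x|lebesgue. f x * f (x + t)) = (LINT x|lebesgue. g x * g (x + t))"
      by (intro integral_cong_AE) (auto intro!: measurable_completion)
    then show ?thesis by (simp add: integral_completion autocorr_def)
  qed
  show ?thesis
  proof
    show "integrable lborel g"
      using transfer(1)[OF f1] integrable_abs_cancel[of lborel g] by simp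
    show "integrable lborel (\<lambda>x. (g x)\<^sup>2)"
      using transfer(1)[OF f2] by simp
    show "Lp_norm 1 f = (LINT x|lborel. \<bar>g x\<bar>)"
      using transfer(2)[OF f1] by (simp add: Lp_norm_def)
    show "Lp_norm 2 f = sqrt (LINT x|lborel. (g x)\<^sup>2)"
      using transfer(2)[OF f2] by (simp add: Lp_norm_def powr_half_sqrt)
  qed (use corr in auto)
qed

lemma set_integral_lebesgue_autocorr:
  assumes "g \<in> borel_measurable borel" "integrable lborel g" "integrable lborel (\<lambda>x. (g x)\<^sup>2)"
  shows "(LINT t:{-1/2..1/2}|lebesgue. autocorr g t) = (LINT t|lborel. autocorr g t * indicator {-(1/2)..1/2} t)"
  using autocorr_measurable[OF assms(1)]
  by (simp add: set_lebesgue_integral_def integral_completion mult.commute)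

lemma Lp_autocorr_bound:
  assumes "f \<in> Lp_space 1 \<inter> Lp_space 2"
  shows "(LINT t:{-1/2..1/2}|lebesgue. (LINT x|lebesgue. f x * f (x + t))) \<le> 0.864 * Lp_norm 1 f * Lp_norm 2 f"
proof -
  from assms obtain g where g: "g \<in> borel_measurable borel" "integrable lborel g" "integrable lborel (\<lambda>x. (g x)\<^sup>2)"
    and norms: "Lp_norm 1 f = (LINT x|lborel. \<bar>g x\<bar>)" "Lp_norm 2 f = sqrt (LINT x|lborel. (g x)\<^sup>2)"
    and corr: "\<And>t. (LINT x|lebesgue. f x * f (x + t)) = autocorr g t"
    by (rule Lp_spaceE) blast
  define h where "h = (\<lambda>x. \<bar>g x\<bar>)"
  have h: "h \<in> borel_measurable borel" "integrable lborel h" "integrable lborel (\<lambda>x. (h x)\<^sup>2)"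
    using g by (auto simp: h_def)
  have i: "integrable lborel (\<lambda>t. autocorr k t * indicator {-(1/2)..1/2} t)"
    if "k \<in> borel_measurable borel" "integrable lborel k" "integrable lborel (\<lambda>x. (k x)\<^sup>2)" for k
    using integrable_autocorr[OF that] by (intro integrable_real_mult_indicator) auto
  have "(LINT t|lborel. autocorr g t * indicator {-(1/2)..1/2} t)
      \<le> (LINT t|lborel. autocorr h t * indicator {-(1/2)..1/2} t)"
    using i[OF g] i[OF h] autocorr_mono_abs[OF g]
    by (intro integral_mono) (auto simp: h_def intro!: mult_right_mono)
  also have "\<dots> \<le> 0.864 * (LINT x|lborel. h x) * sqrt (LINT x|lborel. (h x)\<^sup>2)"
    using h by (intro set_integral_autocorr_le) (auto simp: h_def)
  finally show ?thesis
    unfolding corr set_integral_lebesgue_autocorr[OF g] norms by (simp add: h_def)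
qed

section \<open>The counterexample for 0.8\<close>

definition parabola :: "real \<Rightarrow> real" where
  "parabola x = indicator {-1/2..1/2} x * (1 - 4 * x\<^sup>2)"

lemma integral_lborel_FTC:
  fixes F :: "real \<Rightarrow> real"
  assumes "a \<le> b" and "\<And>x. (F has_real_derivative f x) (at x)" and "continuous_on UNIV f"
  shows "(LINT x|lborel. indicator {a..b} x * f x) = F b - F a"
    and "integrable lborel (\<lambda>x. indicator {a..b} x * f x)"
proof -
  have "has_bochner_integral lborel (\<lambda>x. indicator {a..b} x *\<^sub>R f x) (F b - F a)"
    using assms by (intro has_bochner_integral_FTC_Icc)
      (auto simp: has_real_derivative_iff_has_vector_derivative[symmetric]
        intro: has_field_derivative_at_within continuous_on_subset)
  then show "(LINT x|lborel. indicator {a..b} x * f x) = F b - F a"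
    "integrable lborel (\<lambda>x. indicator {a..b} x * f x)"
    by (auto simp: has_bochner_integral_iff)
qed

lemma parabola_measurable [measurable]: "parabola \<in> borel_measurable borel"
  unfolding parabola_def by measurable

lemma parabola_nonneg: "0 \<le> parabola x"
proof -
  have "x\<^sup>2 \<le> (1/2)\<^sup>2" if "x \<in> {-1/2..1/2}"
    using that by (intro power2_le_iff_abs_le[THEN iffD2]) auto
  then show ?thesis by (auto simp: parabola_def power2_eq_square split: split_indicator)
qed

lemma parabola_sq: "(parabola x)\<^sup>2 = indicator {-1/2..1/2} x * (1 - 4 * x\<^sup>2)\<^sup>2"
  by (simp add: parabola_def split: split_indicator)

lemma parabola_L1: "integrable lborel parabola" "(LINT x|lborel. parabola x) = 2/3"
proof -
  have "((\<lambda>x. x - 4/3 * x^3) has_real_derivative 1 - 4 * x\<^sup>2) (at x)" for x :: real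
    by (auto intro!: derivative_eq_intros)
  moreover have "continuous_on UNIV (\<lambda>x::real. 1 - 4 * x\<^sup>2)" by (intro continuous_intros)
  ultimately show "integrable lborel parabola" "(LINT x|lborel. parabola x) = 2/3"
    using integral_lborel_FTC[of "-1/2" "1/2" "\<lambda>x. x - 4/3 * x^3" "\<lambda>x. 1 - 4 * x\<^sup>2"]
    by (simp_all add: parabola_def[abs_def] power3_eq_cube)
qed

lemma parabola_L2:
  "integrable lborel (\<lambda>x. (parabola x)\<^sup>2)" "(LINT x|lborel. (parabola x)\<^sup>2) = 8/15"
proof -
  have "((\<lambda>x. x - 8/3 * x^3 + 16/5 * x^5) has_real_derivative (1 - 4 * x\<^sup>2)\<^sup>2) (at x)" for x :: real
    by (rule derivative_eq_intros refl)+ (simp add: power2_eq_square power_numeral_reduce algebra_simps)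
  moreover have "continuous_on UNIV (\<lambda>x::real. (1 - 4 * x\<^sup>2)\<^sup>2)" by (intro continuous_intros)
  ultimately show "integrable lborel (\<lambda>x. (parabola x)\<^sup>2)" "(LINT x|lborel. (parabola x)\<^sup>2) = 8/15"
    using integral_lborel_FTC[of "-1/2" "1/2" "\<lambda>x. x - 8/3 * x^3 + 16/5 * x^5" "\<lambda>x. (1 - 4 * x\<^sup>2)\<^sup>2"]
    unfolding parabola_sq by (simp_all add: power_numeral_reduce)
qed

lemma parabola_in_Lp_space: "parabola \<in> Lp_space 1 \<inter> Lp_space 2"
  using parabola_L1(1) parabola_L2(1)
  by (auto simp: Lp_space_def integrable_completion intro!: measurable_completion)

lemma Lp_norm_parabola: "Lp_norm 1 parabola = 2/3" "Lp_norm 2 parabola = sqrt (8/15)"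
  using parabola_L1(2) parabola_L2(2)
  by (simp_all add: Lp_norm_def integral_completion powr_half_sqrt abs_of_nonneg[OF parabola_nonneg] parabola_nonneg)

lemma autocorr_parabola:
  assumes "0 \<le> t" "t \<le> 1/2"
  shows "autocorr parabola t = 8/15 * (1 - 5 * t\<^sup>2 + 5 * t^3 - t^5)"
proof -
  \<comment> \<open>For these t the two supports overlap exactly in [-1/2, 1/2 - t].\<close>
  have "parabola x * parabola (x + t)
      = indicator {-1/2..1/2 - t} x * ((1 - 4 * x\<^sup>2) * (1 - 4 * (x + t)\<^sup>2))" for x
    using assms by (auto simp: parabola_def split: split_indicator)
  then have "autocorr parabola t
      = (LINT x|lborel. indicator {-1/2..1/2 - t} x * ((1 - 4 * x\<^sup>2) * (1 - 4 * (x + t)\<^sup>2)))"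
    by (simp only: autocorr_def)
  also have "\<dots> = 8/15 * (1 - 5 * t\<^sup>2 + 5 * t^3 - t^5)"
  proof (subst integral_lborel_FTC(1))
    let ?F = "\<lambda>x. x - 8/3 * x^3 + 16/5 * x^5 - 4 * t * x\<^sup>2 + 8 * t * x^4 - 4 * t\<^sup>2 * x + 16/3 * t\<^sup>2 * x^3"
    show "(?F has_real_derivative (1 - 4 * x\<^sup>2) * (1 - 4 * (x + t)\<^sup>2)) (at x)" for x
      by (rule derivative_eq_intros refl)+ (simp add: power2_eq_square power_numeral_reduce algebra_simps)
    show "?F (1/2 - t) - ?F (- 1/2) = 8/15 * (1 - 5 * t\<^sup>2 + 5 * t^3 - t^5)"
      by (simp add: power2_eq_square power_numeral_reduce field_simps)
  qed (use assms in \<open>auto intro!: continuous_intros\<close>)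
  finally show ?thesis .
qed

lemma integral_autocorr_parabola:
  "(LINT t:{-1/2..1/2}|lebesgue. (LINT x|lebesgue. parabola x * parabola (x + t))) = 47/120"
proof -
  define P where "P t = 8/15 * (1 - 5 * t\<^sup>2 + 5 * t^3 - t^5)" for t :: real
  have "((\<lambda>t. 8/15 * (t - 5/3 * t^3 + 5/4 * t^4 - 1/6 * t^6)) has_real_derivative P t) (at t)" for t
    unfolding P_def by (rule derivative_eq_intros refl)+ simp
  moreover have "continuous_on UNIV P" unfolding P_def by (intro continuous_intros)
  ultimately have P: "(LINT t|lborel. indicator {0..1/2} t * P t) = 47/240"
    "integrable lborel (\<lambda>t. indicator {0..1/2} t * P t)"
    using integral_lborel_FTC[of "0" "1/2" "\<lambda>t. 8/15 * (t - 5/3 * t^3 + 5/4 * t^4 - 1/6 * t^6)" P]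
    by (simp_all add: power_numeral_reduce)
  have "autocorr parabola t = P \<bar>t\<bar>" if "\<bar>t\<bar> \<le> 1/2" for t
    using autocorr_parabola[of "\<bar>t\<bar>"] that autocorr_minus[of parabola t]
    by (cases "0 \<le> t") (auto simp: P_def)
  \<comment> \<open>By evenness the window splits into [0, 1/2] and its reflection. Both contain 0,
    hence t \<noteq> 0; the form \<open>0 + (-1) * t\<close> matches the affine substitution
    rule.\<close>
  then have eq: "indicator {-1/2..1/2} t * autocorr parabola t
      = indicator {0..1/2} t * P t + indicator {0..1/2} (0 + (-1) * t) * P (0 + (-1) * t)" if "t \<noteq> 0" for t
    using that by (auto split: split_indicator)
  have "(LINT x|lebesgue. parabola x * parabola (x + t)) = autocorr parabola t" for t
    unfolding autocorr_def by (rule integral_completion) measurable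
  then have "(LINT t:{-1/2..1/2}|lebesgue. (LINT x|lebesgue. parabola x * parabola (x + t)))
      = (LINT t|lebesgue. indicator {-1/2..1/2} t * autocorr parabola t)"
    by (simp add: set_lebesgue_integral_def)
  also have "\<dots> = (LINT t|lborel. indicator {-1/2..1/2} t * autocorr parabola t)"
    by (rule integral_completion) measurable
  also have "\<dots> = (LINT t|lborel. indicator {0..1/2} t * P t + indicator {0..1/2} (0 + (-1) * t) * P (0 + (-1) * t))"
  proof (rule integral_cong_AE)
    have "AE t in lborel. t \<noteq> (0::real)" by (rule AE_lborel_singleton)
    then show "AE t in lborel. indicator {-1/2..1/2} t * autocorr parabola t
      = indicator {0..1/2} t * P t + indicator {0..1/2} (0 + (-1) * t) * P (0 + (-1) * t)"
      by eventually_elim (rule eq)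
  qed (unfold P_def, measurable)
  also have "\<dots> = (LINT t|lborel. indicator {0..1/2} t * P t) + (LINT t|lborel. indicator {0..1/2} (0 + (-1) * t) * P (0 + (-1) * t))"
    using P(2) lborel_integrable_real_affine[OF P(2), of "-1" 0] by (intro Bochner_Integration.integral_add) auto
  also have "\<dots> = 47/120"
    using P(1) lborel_integral_real_affine[of "-1" "\<lambda>t. indicator {0..1/2} t * P t" 0] by simp
  finally show ?thesis .
qed

lemma parabola_exceeds:
  "0.8 * Lp_norm 1 parabola * Lp_norm 2 parabola
    < (LINT t:{-1/2..1/2}|lebesgue. (LINT x|lebesgue. parabola x * parabola (x + t)))"
proof -
  \<comment> \<open>This is sharp enough: 0.8 * 2/3 * 0.734 is about 0.39147, while 47/120 is about
    0.39167.\<close>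
  have "sqrt (8/15) < 0.734"
    by (rule real_less_lsqrt) (auto simp: power2_eq_square)
  then show ?thesis unfolding Lp_norm_parabola integral_autocorr_parabola by simp
qed

theorem theorem1p1:
  "(\<forall>f :: real \<Rightarrow> real. f \<in> Lp_space 1 \<inter> Lp_space 2 \<longrightarrow>
      (LINT t:{-1/2..1/2}|lebesgue. (LINT x|lebesgue. f x * f (x + t)))
        \<le> 0.864 * Lp_norm 1 f * Lp_norm 2 f) \<and>
   \<not> (\<forall>f :: real \<Rightarrow> real. f \<in> Lp_space 1 \<inter> Lp_space 2 \<longrightarrow>
      (LINT t:{-1/2..1/2}|lebesgue. (LINT x|lebesgue. f x * f (x + t)))
        \<le> 0.8 * Lp_norm 1 f * Lp_norm 2 f)"
proof
  show "\<forall>f :: real \<Rightarrow> real. f \<in> Lp_space 1 \<inter> Lp_space 2 \<longrightarrow>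
      (LINT t:{-1/2..1/2}|lebesgue. (LINT x|lebesgue. f x * f (x + t)))
        \<le> 0.864 * Lp_norm 1 f * Lp_norm 2 f"
    using Lp_autocorr_bound by blast
  show "\<not> (\<forall>f :: real \<Rightarrow> real. f \<in> Lp_space 1 \<inter> Lp_space 2 \<longrightarrow>
      (LINT t:{-1/2..1/2}|lebesgue. (LINT x|lebesgue. f x * f (x + t)))
        \<le> 0.8 * Lp_norm 1 f * Lp_norm 2 f)"
    using parabola_exceeds parabola_in_Lp_space not_less by blast
qed

end
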